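(* Let $n\ge 1$. The diffeomorphism $\chi:H_n\to P$ defined by $$\chi:\ g=\begin{pmatrix}1&\bar a&z\\0&I_n&\bar b\\0&0&1\end{pmatrix}\ \longmapsto\ m=\begin{pmatrix}-z\\ \bar b\\ \bar a\end{pmatrix}$$ (that is, $x^0=-z$, $p_i=b_i$, $x^i=a^i$) determines an isomorphism of the thermodynamical metric contact manifold $(P,\theta,G)$ with the Heisenberg group $H_n$ endowed with the right invariant contact form $\theta_H$ and the right invariant metric $G_H$ of signature $(n+1,n)$. Explicitly: the contact form $\theta_H=\chi^*\theta=-dz+\sum_{i=1}^n b_i\,da^i$ and the pseudo-Riemannian metric $G_H=\chi^*G$, which has signature $(n+1,n)$, are both invariant under all right translations of $H_n$.
   Context: $P=\mathbb{R}^{2n+1}$ with coordinates $(x^0;p_1,\dots,p_n;x^1,\dots,x^n)$ carries the contact form $\theta=dx^0+\sum_{i=1}^n p_i\,dx^i$ and the pseudo-Riemannian (Mrugala) metric $G=2\sum_{k=1}^n dp_k\odot dx^k+\theta\otimes\theta$, where $dp_k\odot dx^k=\frac12(dp_k\otimes dx^k+dx^k\otimes dp_k)$. $H_n$ is the Heisenberg group of real $(n+2)\times(n+2)$ matrices $\begin{pmatrix}1&\bar a&z\\0&I_n&\bar b\\0&0&1\end{pmatrix}$ with $\bar a\in\mathbb{R}^n$ (a row), $\bar b\in\mathbb{R}^n$ (a column) and $z\in\mathbb{R}$, under matrix multiplication. An isomorphism here is a diffeomorphism that pulls back the contact form and the metric of the target to those of the source. *)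

theory Defs
  imports "HOL-Analysis.Analysis" "HOL-Combinatorics.Permutations" "HOL-Algebra.Group"
begin

section \<open>Smooth maps between subsets of Euclidean spaces\<close>

text \<open>
  Manifolds are treated as subsets of an ambient Euclidean space. On an open set, \<open>Ck_on k\<close> is the
  usual class of \<open>k\<close> times continuously differentiable maps (differentiation in every constant
  direction); a map on an arbitrary subset is smooth if it extends, locally around each point, to
  a smooth map on an open set of the ambient space.
\<close>

primrec Ck_on :: "nat \<Rightarrow> 'a::euclidean_space set \<Rightarrow> ('a \<Rightarrow> 'b::euclidean_space) \<Rightarrow> bool" where
  "Ck_on 0 U f = continuous_on U f"
| "Ck_on (Suc k) U f =
     ((\<forall>x\<in>U. f differentiable (at x)) \<and>
      (\<forall>v. Ck_on k U (\<lambda>x. frechet_derivative f (at x) v)))"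

definition smooth_open :: "'a::euclidean_space set \<Rightarrow> ('a \<Rightarrow> 'b::euclidean_space) \<Rightarrow> bool" where
  "smooth_open U f \<longleftrightarrow> open U \<and> (\<forall>k. Ck_on k U f)"

definition smooth_map :: "'a::euclidean_space set \<Rightarrow> ('a \<Rightarrow> 'b::euclidean_space) \<Rightarrow> bool" where
  "smooth_map S f \<longleftrightarrow>
     (\<forall>x\<in>S. \<exists>U F. x \<in> U \<and> smooth_open U F \<and> (\<forall>y\<in>S \<inter> U. F y = f y))"

definition diffeomorphism ::
    "'a::euclidean_space set \<Rightarrow> 'b::euclidean_space set \<Rightarrow> ('a \<Rightarrow> 'b) \<Rightarrow> bool" where
  "diffeomorphism S T f \<longleftrightarrow> bij_betw f S T \<and> smooth_map S f \<and> smooth_map T (inv_into S f)"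

definition curve_in :: "'a::euclidean_space set \<Rightarrow> 'a \<Rightarrow> 'a \<Rightarrow> (real \<Rightarrow> 'a) \<Rightarrow> bool" where
  "curve_in S x v \<gamma> \<longleftrightarrow>
     (\<exists>e>0. smooth_open {-e<..<e} \<gamma> \<and> \<gamma> ` {-e<..<e} \<subseteq> S) \<and>
     \<gamma> 0 = x \<and> (\<gamma> has_vector_derivative v) (at 0)"

definition tangent_space :: "'a::euclidean_space set \<Rightarrow> 'a \<Rightarrow> 'a set" where
  "tangent_space S x = {v. \<exists>\<gamma>. curve_in S x v \<gamma>}"

text \<open>
  Only meaningful for \<open>v \<in> tangent_space S x\<close> and \<open>f\<close> smooth on \<open>S\<close>; then the value depends only
  on \<open>f\<close> restricted to \<open>S\<close>.
\<close>

definition differential ::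
    "'a::euclidean_space set \<Rightarrow> ('a \<Rightarrow> 'b::euclidean_space) \<Rightarrow> 'a \<Rightarrow> 'a \<Rightarrow> 'b" where
  "differential S f x v =
     (THE w. \<exists>\<gamma>. curve_in S x v \<gamma> \<and> ((\<lambda>t. f (\<gamma> t)) has_vector_derivative w) (at 0))"


section \<open>One-forms, covariant 2-tensors, contact forms and metrics\<close>

text \<open>
  Covariant tensor fields are functions of the base point and of tangent vectors; their values at
  arguments that are not tangent to the manifold are irrelevant.
\<close>

type_synonym 'a form1 = "'a \<Rightarrow> 'a \<Rightarrow> real"
type_synonym 'a tensor2 = "'a \<Rightarrow> 'a \<Rightarrow> 'a \<Rightarrow> real"

definition pullback1 ::
    "'a::euclidean_space set \<Rightarrow> ('a \<Rightarrow> 'b::euclidean_space) \<Rightarrow> 'b form1 \<Rightarrow> 'a form1" where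
  "pullback1 S f \<omega> x v = \<omega> (f x) (differential S f x v)"

definition pullback2 ::
    "'a::euclidean_space set \<Rightarrow> ('a \<Rightarrow> 'b::euclidean_space) \<Rightarrow> 'b tensor2 \<Rightarrow> 'a tensor2" where
  "pullback2 S f g x v w = g (f x) (differential S f x v) (differential S f x w)"

definition form1_eq :: "'a::euclidean_space set \<Rightarrow> 'a form1 \<Rightarrow> 'a form1 \<Rightarrow> bool" where
  "form1_eq S \<omega> \<eta> \<longleftrightarrow> (\<forall>x\<in>S. \<forall>v\<in>tangent_space S x. \<omega> x v = \<eta> x v)"

definition tensor2_eq :: "'a::euclidean_space set \<Rightarrow> 'a tensor2 \<Rightarrow> 'a tensor2 \<Rightarrow> bool" where
  "tensor2_eq S g h \<longleftrightarrow>
     (\<forall>x\<in>S. \<forall>v\<in>tangent_space S x. \<forall>w\<in>tangent_space S x. g x v w = h x v w)"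

definition form1_extension ::
    "'a::euclidean_space set \<Rightarrow> 'a form1 \<Rightarrow> 'a set \<Rightarrow> 'a form1 \<Rightarrow> bool" where
  "form1_extension S \<omega> U \<Omega> \<longleftrightarrow>
     open U \<and> (\<forall>y\<in>U. linear (\<Omega> y)) \<and> (\<forall>v. smooth_open U (\<lambda>y. \<Omega> y v)) \<and>
     (\<forall>y\<in>S \<inter> U. \<forall>v\<in>tangent_space S y. \<Omega> y v = \<omega> y v)"

definition smooth_form1 :: "'a::euclidean_space set \<Rightarrow> 'a form1 \<Rightarrow> bool" where
  "smooth_form1 S \<omega> \<longleftrightarrow> (\<forall>x\<in>S. \<exists>U \<Omega>. x \<in> U \<and> form1_extension S \<omega> U \<Omega>)"

definition smooth_tensor2 :: "'a::euclidean_space set \<Rightarrow> 'a tensor2 \<Rightarrow> bool" where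
  "smooth_tensor2 S g \<longleftrightarrow>
     (\<forall>x\<in>S. \<exists>U \<Gamma>. x \<in> U \<and> open U \<and> (\<forall>y\<in>U. bilinear (\<Gamma> y)) \<and>
        (\<forall>v w. smooth_open U (\<lambda>y. \<Gamma> y v w)) \<and>
        (\<forall>y\<in>S \<inter> U. \<forall>v\<in>tangent_space S y. \<forall>w\<in>tangent_space S y. \<Gamma> y v w = g y v w))"

text \<open>
  \<open>d\<omega>(u, v) = \<partial>\<^sub>u(\<Omega>(v)) - \<partial>\<^sub>v(\<Omega>(u))\<close> for constant ambient \<open>u\<close>, \<open>v\<close>. For vectors tangent to a
  submanifold the value does not depend on the chosen local extension \<open>\<Omega>\<close> of \<open>\<omega>\<close>, the exterior
  derivative being natural under the inclusion.
\<close>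

definition ext_deriv1 :: "'a::euclidean_space set \<Rightarrow> 'a form1 \<Rightarrow> 'a tensor2" where
  "ext_deriv1 S \<omega> x u v =
     (THE r. \<exists>U \<Omega>. x \<in> U \<and> form1_extension S \<omega> U \<Omega> \<and>
        r = frechet_derivative (\<lambda>y. \<Omega> y v) (at x) u - frechet_derivative (\<lambda>y. \<Omega> y u) (at x) v)"

text \<open>
  The value of \<open>\<alpha> \<and> \<beta> \<and> \<dots> \<and> \<beta>\<close> (\<open>n\<close> factors \<open>\<beta>\<close>), for a covector \<open>\<alpha>\<close> and an alternating
  2-form \<open>\<beta>\<close>, on the vectors \<open>v 0, \<dots>, v (2 * n)\<close>. The factor \<open>1 / 2 ^ n\<close> is the one of
  \<open>(\<alpha> \<and> \<beta>) = (k + l)! / (k! l!) Alt(\<alpha> \<otimes> \<beta>)\<close>.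
\<close>

definition wedge_power :: "nat \<Rightarrow> ('a \<Rightarrow> real) \<Rightarrow> ('a \<Rightarrow> 'a \<Rightarrow> real) \<Rightarrow> (nat \<Rightarrow> 'a) \<Rightarrow> real" where
  "wedge_power n \<alpha> \<beta> v =
     (\<Sum>\<sigma> | \<sigma> permutes {..2 * n}.
        of_int (sign \<sigma>) * \<alpha> (v (\<sigma> 0)) *
        (\<Prod>k<n. \<beta> (v (\<sigma> (2 * k + 1))) (v (\<sigma> (2 * k + 2))))) / 2 ^ n"

text \<open>A contact form on a manifold of dimension \<open>2 * n + 1\<close>: \<open>\<omega> \<and> (d\<omega>)\<^sup>n\<close> vanishes nowhere.\<close>

definition contact_form :: "nat \<Rightarrow> 'a::euclidean_space set \<Rightarrow> 'a form1 \<Rightarrow> bool" where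
  "contact_form n S \<omega> \<longleftrightarrow>
     smooth_form1 S \<omega> \<and>
     (\<forall>x\<in>S. dim (tangent_space S x) = 2 * n + 1 \<and>
        (\<exists>v. (\<forall>i\<le>2 * n. v i \<in> tangent_space S x) \<and>
             wedge_power n (\<omega> x) (ext_deriv1 S \<omega> x) v \<noteq> 0))"

text \<open>Signature \<open>(p, q)\<close>: \<open>p\<close> positive and \<open>q\<close> negative squares in a diagonalising basis of \<open>V\<close>.\<close>

definition has_signature ::
    "'a::euclidean_space set \<Rightarrow> ('a \<Rightarrow> 'a \<Rightarrow> real) \<Rightarrow> nat \<Rightarrow> nat \<Rightarrow> bool" where
  "has_signature V g p q \<longleftrightarrow>
     (\<exists>B. independent B \<and> span B = V \<and> pairwise (\<lambda>u v. g u v = 0) B \<and>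
          (\<forall>u\<in>B. g u u \<noteq> 0) \<and> card {u\<in>B. g u u > 0} = p \<and> card {u\<in>B. g u u < 0} = q)"

definition pseudo_riemannian_metric ::
    "'a::euclidean_space set \<Rightarrow> 'a tensor2 \<Rightarrow> nat \<Rightarrow> nat \<Rightarrow> bool" where
  "pseudo_riemannian_metric S g p q \<longleftrightarrow>
     smooth_tensor2 S g \<and>
     (\<forall>x\<in>S. (\<forall>v\<in>tangent_space S x. \<forall>w\<in>tangent_space S x. g x v w = g x w v) \<and>
        has_signature (tangent_space S x) (g x) p q)"

definition metric_contact_isomorphism ::
    "'a::euclidean_space set \<Rightarrow> 'a form1 \<Rightarrow> 'a tensor2 \<Rightarrow>
     'b::euclidean_space set \<Rightarrow> 'b form1 \<Rightarrow> 'b tensor2 \<Rightarrow> ('a \<Rightarrow> 'b) \<Rightarrow> bool" where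
  "metric_contact_isomorphism S \<omega> g T \<eta> h f \<longleftrightarrow>
     diffeomorphism S T f \<and> form1_eq S (pullback1 S f \<eta>) \<omega> \<and> tensor2_eq S (pullback2 S f h) g"


section \<open>The thermodynamical phase space\<close>

text \<open>A point of \<open>P = \<real>\<^bsup>2n+1\<^esup>\<close>, \<open>n = CARD('n)\<close>, is the triple of \<open>x\<^sup>0\<close>, \<open>(p\<^sub>i)\<^sub>i\<close> and \<open>(x\<^sup>i)\<^sub>i\<close>.\<close>

type_synonym 'n phase = "real \<times> (real^'n) \<times> (real^'n)"

abbreviation (input) x0_coord :: "'n::finite phase \<Rightarrow> real" where "x0_coord m \<equiv> fst m"
abbreviation (input) p_coord :: "'n::finite phase \<Rightarrow> 'n \<Rightarrow> real" where
  "p_coord m i \<equiv> fst (snd m) $ i"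
abbreviation (input) x_coord :: "'n::finite phase \<Rightarrow> 'n \<Rightarrow> real" where
  "x_coord m i \<equiv> snd (snd m) $ i"

text \<open>The coordinates being linear, each is its own differential.\<close>

definition thermo_form :: "'n::finite phase form1" where
  "thermo_form m v = x0_coord v + (\<Sum>i\<in>UNIV. p_coord m i * x_coord v i)"

definition mrugala_metric :: "'n::finite phase tensor2" where
  "mrugala_metric m v w =
     2 * (\<Sum>k\<in>UNIV. 1 / 2 * (p_coord v k * x_coord w k + x_coord v k * p_coord w k))
     + thermo_form m v * thermo_form m w"


section \<open>The Heisenberg group\<close>

text \<open>
  The index type \<open>unit + 'n + unit\<close> of the \<open>(n + 2) \<times> (n + 2)\<close> matrices reflects the block
  decomposition.
\<close>

type_synonym 'n block = "unit + 'n + unit"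
type_synonym 'n hmat = "real^'n block^'n block"

abbreviation (input) top_idx :: "'n block" where "top_idx \<equiv> Inl ()"
abbreviation (input) mid_idx :: "'n \<Rightarrow> 'n block" where "mid_idx i \<equiv> Inr (Inl i)"
abbreviation (input) bot_idx :: "'n block" where "bot_idx \<equiv> Inr (Inr ())"

definition heis_mat :: "real^'n::finite \<Rightarrow> real^'n \<Rightarrow> real \<Rightarrow> 'n hmat" where
  "heis_mat a b z =
     (\<chi> r c. case r of
        Inl _ \<Rightarrow> (case c of Inl _ \<Rightarrow> 1 | Inr (Inl j) \<Rightarrow> a $ j | Inr (Inr _) \<Rightarrow> z)
      | Inr (Inl i) \<Rightarrow>
          (case c of Inl _ \<Rightarrow> 0 | Inr (Inl j) \<Rightarrow> (if i = j then 1 else 0) | Inr (Inr _) \<Rightarrow> b $ i)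
      | Inr (Inr _) \<Rightarrow> (case c of Inl _ \<Rightarrow> 0 | Inr (Inl j) \<Rightarrow> 0 | Inr (Inr _) \<Rightarrow> 1))"

definition heisenberg :: "'n::finite hmat monoid" where
  "heisenberg = \<lparr>carrier = {heis_mat a b z | a b z. True}, mult = (**), one = mat 1\<rparr>"

definition a_coord :: "'n::finite \<Rightarrow> 'n hmat \<Rightarrow> real" where
  "a_coord i g = g $ top_idx $ mid_idx i"
definition b_coord :: "'n::finite \<Rightarrow> 'n hmat \<Rightarrow> real" where
  "b_coord i g = g $ mid_idx i $ bot_idx"
definition z_coord :: "'n::finite hmat \<Rightarrow> real" where "z_coord g = g $ top_idx $ bot_idx"

definition heis_chart :: "'n::finite hmat \<Rightarrow> 'n phase" where
  "heis_chart g = (- z_coord g, (\<chi> i. b_coord i g), (\<chi> i. a_coord i g))"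

definition heis_form :: "'n::finite hmat form1" where
  "heis_form g v =
     - differential (carrier heisenberg) z_coord g v
     + (\<Sum>i\<in>UNIV. b_coord i g * differential (carrier heisenberg) (a_coord i) g v)"

definition heis_metric :: "'n::finite hmat tensor2" where
  "heis_metric = pullback2 (carrier heisenberg) heis_chart mrugala_metric"

definition right_invariant1 :: "('a::euclidean_space, 'm) monoid_scheme \<Rightarrow> 'a form1 \<Rightarrow> bool" where
  "right_invariant1 G \<omega> \<longleftrightarrow>
     (\<forall>h\<in>carrier G. form1_eq (carrier G) (pullback1 (carrier G) (\<lambda>g. g \<otimes>\<^bsub>G\<^esub> h) \<omega>) \<omega>)"

definition right_invariant2 :: "('a::euclidean_space, 'm) monoid_scheme \<Rightarrow> 'a tensor2 \<Rightarrow> bool" where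
  "right_invariant2 G g \<longleftrightarrow>
     (\<forall>h\<in>carrier G. tensor2_eq (carrier G) (pullback2 (carrier G) (\<lambda>x. x \<otimes>\<^bsub>G\<^esub> h) g) g)"

lemma heis_coord_simps [simp]:
  "a_coord i (heis_mat a b z) = a $ i" "b_coord i (heis_mat a b z) = b $ i"
  "z_coord (heis_mat a b z) = z"
  by (simp_all add: a_coord_def b_coord_def z_coord_def heis_mat_def)

lemma heis_chart_heis_mat: "heis_chart (heis_mat a b z) = (- z, b, a)"
  by (simp add: heis_chart_def)

lemma sum_UNIV_block:
  "(\<Sum>r\<in>UNIV. f r) = f top_idx + (\<Sum>i\<in>UNIV. f (mid_idx i)) + f bot_idx"
  for f :: "'n::finite block \<Rightarrow> real"
proof -
  have "(\<Sum>r\<in>UNIV. f r) = (\<Sum>r\<in>UNIV. f (Inl r)) + (\<Sum>s\<in>UNIV. f (Inr s))"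
    by (simp add: UNIV_Plus_UNIV [symmetric] sum.Plus o_def del: UNIV_Plus_UNIV)
  also have "(\<Sum>s\<in>UNIV. f (Inr s)) = (\<Sum>i\<in>UNIV. f (mid_idx i)) + (\<Sum>u\<in>UNIV. f (Inr (Inr u)))"
    by (simp add: UNIV_Plus_UNIV [symmetric] sum.Plus o_def del: UNIV_Plus_UNIV)
  finally show ?thesis by (simp add: UNIV_unit)
qed

lemma heis_mat_mult:
  "heis_mat a b z ** heis_mat a' b' z' = heis_mat (a + a') (b + b') (z + z' + a \<bullet> b')"
  by (auto simp: vec_eq_iff matrix_matrix_mult_def sum_UNIV_block heis_mat_def inner_vec_def
        if_distrib [where f = "\<lambda>x. x * c" for c] if_distrib [where f = "\<lambda>x. c * x" for c]
        cong: if_cong split: sum.split)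

lemma heis_mat_one: "mat 1 = heis_mat 0 0 0"
  by (auto simp: vec_eq_iff mat_def heis_mat_def split: sum.split)

lemma group_heisenberg: "group (heisenberg :: 'n::finite hmat monoid)"
proof (rule groupI)
  fix x :: "'n hmat"
  assume "x \<in> carrier heisenberg"
  then obtain a b z where x: "x = heis_mat a b z" by (auto simp: heisenberg_def)
  have "heis_mat (- a) (- b) (a \<bullet> b - z) ** x = mat 1"
    by (simp add: x heis_mat_mult heis_mat_one)
  then show "\<exists>y\<in>carrier heisenberg. y \<otimes>\<^bsub>heisenberg\<^esub> x = \<one>\<^bsub>heisenberg\<^esub>"
    by (force simp: heisenberg_def)
qed (auto simp: heisenberg_def heis_mat_mult heis_mat_one algebra_simps inner_add_left inner_add_right
      | blast)+

end

theory Submission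
  imports Defs
begin

text \<open>
  Inside the space of matrices \<open>H\<^sub>n\<close> is an affine subspace, and the chart is the restriction of a
  linear map. Hence every tangent space is the direction space of this affine subspace, the
  differentials of the chart and of the right translations are these linear maps themselves, and all
  tensors have global polynomial extensions. Right translation by \<open>(a', b', z')\<close> changes \<open>dz\<close> by
  \<open>\<Sum> b'\<^sub>i da\<^sup>i\<close> and \<open>b\<close> by \<open>b'\<close>, and these changes cancel in \<open>-dz + \<Sum> b\<^sub>i da\<^sup>i\<close>. The form is contact because
  the frame consisting of the Reeb field and of \<open>n\<close> symplectic pairs spanning its kernel gives the
  top power only nonnegative terms, one of them positive; the metric is diagonalised by the Reeb
  field and the sums and differences of these pairs.
\<close>

abbreviation (input) swap :: "nat \<Rightarrow> nat \<Rightarrow> nat \<Rightarrow> nat" where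
  "swap \<equiv> Transposition.transpose"


section \<open>Smoothness and tangent vectors of affine subspaces\<close>

text \<open>Lets an explicit derivative replace \<open>frechet_derivative\<close> in the recursion
  of \<open>Ck_on\<close>; having all orders for the derivative makes a case split on
  \<open>k\<close> enough.\<close>

lemma Ck_on_has_derivative:
  fixes f :: "'a::euclidean_space \<Rightarrow> 'b::euclidean_space"
  assumes "\<And>x. (f has_derivative f' x) (at x)" and "\<And>k v. Ck_on k U (\<lambda>x. f' x v)"
  shows "Ck_on k U f"
proof (cases k)
  case 0
  show ?thesis
    unfolding 0 Ck_on.simps
    by (intro continuous_at_imp_continuous_on ballI has_derivative_continuous [OF assms(1)])
next
  case (Suc j)
  have "frechet_derivative f (at x) = f' x" for x
    using frechet_derivative_at [OF assms(1)] by simp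
  with Suc assms show ?thesis
    by (auto simp: differentiable_def)
qed

lemma Ck_on_const: "Ck_on k U (\<lambda>x. c)"
  by (induction k arbitrary: c) (auto simp: frechet_derivative_const)

lemma Ck_on_linear:
  assumes "linear f"
  shows "Ck_on k U (\<lambda>x. c + f x)"
  by (rule Ck_on_has_derivative [where f' = "\<lambda>x. f"])
    (auto intro!: derivative_eq_intros linear_imp_has_derivative assms Ck_on_const)

text \<open>The coefficients of the metric have this shape. Their derivatives are affine, which
  leads back to \<open>Ck_on_linear\<close>.\<close>

lemma Ck_on_mult_linear:
  fixes f g :: "'a::euclidean_space \<Rightarrow> real"
  assumes "linear f" "linear g"
  shows "Ck_on k U (\<lambda>x. d + (a + f x) * (b + g x))"
proof (rule Ck_on_has_derivative [where f' = "\<lambda>x v. (a + f x) * g v + f v * (b + g x)"])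
  show "((\<lambda>x. d + (a + f x) * (b + g x)) has_derivative
         (\<lambda>v. (a + f x) * g v + f v * (b + g x))) (at x)" for x
    by (auto intro!: derivative_eq_intros linear_imp_has_derivative assms)
  fix k :: nat and v
  have "Ck_on k U (\<lambda>x. (a * g v + f v * b) + (f x * g v + f v * g x))"
    by (intro Ck_on_linear linearI)
      (auto simp: linear_add [OF assms(1)] linear_add [OF assms(2)]
        linear_scale [OF assms(1)] linear_scale [OF assms(2)] algebra_simps)
  then show "Ck_on k U (\<lambda>x. (a + f x) * g v + f v * (b + g x))"
    by (simp add: algebra_simps)
qed

lemma smooth_map_linear:
  assumes "linear f" and "\<And>y. y \<in> S \<Longrightarrow> g y = c + f y"
  shows "smooth_map S g"
  unfolding smooth_map_def smooth_open_def
  by (intro ballI exI [of _ UNIV] exI [of _ "\<lambda>x. c + f x"])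
    (use assms in \<open>auto simp: Ck_on_linear\<close>)

lemma curve_in_line:
  assumes "subspace V" "x \<in> (+) c ` V" "v \<in> V"
  shows "curve_in ((+) c ` V) x v (\<lambda>t. x + t *\<^sub>R v)"
proof -
  have "x + t *\<^sub>R v \<in> (+) c ` V" for t
  proof -
    from assms(2) obtain u where "u \<in> V" "x = c + u" by auto
    moreover from this assms have "u + t *\<^sub>R v \<in> V"
      by (auto intro: subspace_add subspace_scale)
    ultimately show ?thesis by (auto simp: add.assoc)
  qed
  moreover have "linear (\<lambda>t. t *\<^sub>R v)"
    by (auto intro!: linearI simp: algebra_simps)
  then have "smooth_open {-1<..<1} (\<lambda>t. x + t *\<^sub>R v)"
    by (auto simp: smooth_open_def intro: Ck_on_linear)
  moreover have "((\<lambda>t. x + t *\<^sub>R v) has_vector_derivative v) (at 0)"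
    by (auto intro!: derivative_eq_intros)
  ultimately show ?thesis
    unfolding curve_in_def by (auto intro!: exI [of _ 1])
qed

text \<open>Lines realise every vector of \<open>V\<close>. Conversely, a normal vector of
  \<open>V\<close> has constant inner product with a curve in the affine subspace, so velocities lie
  in the double orthogonal complement, which is \<open>V\<close>.\<close>

lemma tangent_space_affine:
  assumes V: "subspace V" and x: "x \<in> (+) c ` V"
  shows "tangent_space ((+) c ` V) x = V"
proof
  show "V \<subseteq> tangent_space ((+) c ` V) x"
    using curve_in_line [OF V x] by (auto simp: tangent_space_def)
  show "tangent_space ((+) c ` V) x \<subseteq> V"
  proof
    fix v assume "v \<in> tangent_space ((+) c ` V) x"
    then obtain \<gamma> e where e: "e > 0" "\<gamma> ` {-e<..<e} \<subseteq> (+) c ` V"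
      and \<gamma>: "(\<gamma> has_vector_derivative v) (at 0)"
      by (auto simp: tangent_space_def curve_in_def)
    have "w \<bullet> v = 0" if w: "w \<in> orthogonal_comp V" for w
    proof -
      have "w \<bullet> \<gamma> t = w \<bullet> c" if t: "t \<in> {-e<..<e}" for t
      proof -
        from e t obtain u where "u \<in> V" "\<gamma> t = c + u" by blast
        with w show ?thesis
          by (auto simp: orthogonal_comp_def orthogonal_def inner_add_right inner_commute)
      qed
      moreover have "((\<lambda>t. w \<bullet> \<gamma> t) has_vector_derivative w \<bullet> v) (at 0)"
        using \<gamma> by (rule bounded_linear.has_vector_derivative [OF bounded_linear_inner_right])
      ultimately have "((\<lambda>t. w \<bullet> c) has_vector_derivative w \<bullet> v) (at 0)"
        using e(1) by (elim has_vector_derivative_transform_within_open [of _ _ _ "{-e<..<e}"]) auto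
      then show ?thesis
        using has_vector_derivative_const vector_derivative_unique_at by blast
    qed
    then have "v \<in> orthogonal_comp (orthogonal_comp V)"
      by (auto simp: orthogonal_comp_def orthogonal_def)
    then show "v \<in> V"
      by (simp add: orthogonal_comp_self V)
  qed
qed

text \<open>By the chain rule all curves with velocity \<open>v\<close> give the same derivative,
  and tangency supplies such a curve, so the \<open>THE\<close> is determined.\<close>

lemma differential_linear:
  fixes f :: "'a::euclidean_space \<Rightarrow> 'b::euclidean_space"
  assumes f: "linear f" and v: "v \<in> tangent_space S x"
  shows "differential S f x v = f v"
proof -
  have *: "((\<lambda>t. f (\<gamma> t)) has_vector_derivative f v) (at 0)" if "curve_in S x v \<gamma>" for \<gamma>
    using that f
    by (auto simp: curve_in_def linear_conv_bounded_linear
        intro: bounded_linear.has_vector_derivative)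
  from v obtain \<gamma> where "curve_in S x v \<gamma>" by (auto simp: tangent_space_def)
  with * show ?thesis
    unfolding differential_def
    by (intro the_equality) (blast dest: vector_derivative_unique_at)+
qed

text \<open>
  Two extensions agree only on the affine subspace, which suffices because it contains the line
  through \<open>x\<close> in the direction \<open>u\<close>.
\<close>

lemma form1_extension_directional:
  assumes V: "subspace V" and x: "x \<in> (+) c ` V" "x \<in> U" "x \<in> U'"
    and ext: "form1_extension ((+) c ` V) \<omega> U \<Omega>" "form1_extension ((+) c ` V) \<omega> U' \<Omega>'"
    and u: "u \<in> V" and v: "v \<in> V"
  shows "frechet_derivative (\<lambda>y. \<Omega> y v) (at x) u = frechet_derivative (\<lambda>y. \<Omega>' y v) (at x) u"
proof -
  let ?l = "\<lambda>t. x + t *\<^sub>R u"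
  have deriv: "((\<lambda>t. W (?l t) v) has_vector_derivative frechet_derivative (\<lambda>y. W y v) (at x) u) (at 0)"
    if W: "form1_extension ((+) c ` V) \<omega> A W" and xA: "x \<in> A" for A W
  proof -
    from W have "Ck_on (Suc 0) A (\<lambda>y. W y v)"
      by (simp add: form1_extension_def smooth_open_def del: Ck_on.simps)
    with xA have "(\<lambda>y. W y v) differentiable (at x)" by simp
    then have "((\<lambda>y. W y v) has_derivative frechet_derivative (\<lambda>y. W y v) (at x)) (at (?l 0))"
      by (simp add: frechet_derivative_works)
    moreover have "(?l has_vector_derivative u) (at 0)"
      by (auto intro!: derivative_eq_intros)
    ultimately show ?thesis
      using vector_derivative_diff_chain_within [of ?l u 0 UNIV "\<lambda>y. W y v"]
      by (simp add: o_def has_derivative_at_withinI)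
  qed
  let ?T = "?l -` (U \<inter> U')"
  have "open (U \<inter> U')"
    using ext by (auto simp: form1_extension_def)
  then have T: "open ?T"
    by (rule continuous_open_vimage) (auto intro!: continuous_intros)
  have "\<Omega> (?l t) v = \<Omega>' (?l t) v" if "t \<in> ?T" for t
  proof -
    have "?l t \<in> (+) c ` V"
    proof -
      from x obtain w where "w \<in> V" "x = c + w" by auto
      with V u show ?thesis
        by (auto simp: add.assoc intro!: imageI subspace_add subspace_scale)
    qed
    with that ext v show ?thesis
      by (auto simp: form1_extension_def tangent_space_affine [OF V])
  qed
  with deriv [OF ext(1) x(2)] T x
  have "((\<lambda>t. \<Omega>' (?l t) v) has_vector_derivative frechet_derivative (\<lambda>y. \<Omega> y v) (at x) u) (at 0)"
    by (elim has_vector_derivative_transform_within_open [of _ _ _ ?T]) auto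
  with deriv [OF ext(2) x(3)] show ?thesis
    by (blast dest: vector_derivative_unique_at)
qed

text \<open>Independence of the extension makes the \<open>THE\<close> in \<open>ext_deriv1\<close>
  unique, so any convenient extension computes it.\<close>

lemma ext_deriv1_affine:
  assumes V: "subspace V" and x: "x \<in> (+) c ` V" "x \<in> U"
    and ext: "form1_extension ((+) c ` V) \<omega> U \<Omega>" and u: "u \<in> V" and v: "v \<in> V"
  shows "ext_deriv1 ((+) c ` V) \<omega> x u v =
    frechet_derivative (\<lambda>y. \<Omega> y v) (at x) u - frechet_derivative (\<lambda>y. \<Omega> y u) (at x) v"
  unfolding ext_deriv1_def
proof (rule the_equality)
  fix r
  assume "\<exists>U' \<Omega>'. x \<in> U' \<and> form1_extension ((+) c ` V) \<omega> U' \<Omega>' \<and>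
    r = frechet_derivative (\<lambda>y. \<Omega>' y v) (at x) u - frechet_derivative (\<lambda>y. \<Omega>' y u) (at x) v"
  then show "r = frechet_derivative (\<lambda>y. \<Omega> y v) (at x) u - frechet_derivative (\<lambda>y. \<Omega> y u) (at x) v"
    using form1_extension_directional [OF V x(1) _ x(2) _ ext] u v by auto
qed (use ext x in blast)


section \<open>Top powers in a symplectic frame\<close>

text \<open>With \<open>J\<close> the matrix of a 2-form, this is a summand of the permutation
  expansion of the Pfaffian. Positions start at 1 because position 0 belongs to the
  covector.\<close>

definition pair_term :: "nat \<Rightarrow> (nat \<Rightarrow> nat \<Rightarrow> real) \<Rightarrow> (nat \<Rightarrow> nat) \<Rightarrow> real" where
  "pair_term n J \<sigma> = of_int (sign \<sigma>) * (\<Prod>k<n. J (\<sigma> (2 * k + 1)) (\<sigma> (2 * k + 2)))"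

text \<open>The transposition negates the sign of the permutation and, by antisymmetry, the
  \<open>m\<close>-th factor alone.\<close>

lemma pair_term_flip:
  assumes "m < n" "permutation \<sigma>"
    and J: "J (\<sigma> (2 * m + 2)) (\<sigma> (2 * m + 1)) = - J (\<sigma> (2 * m + 1)) (\<sigma> (2 * m + 2))"
  shows "pair_term n J (\<sigma> \<circ> swap (2 * m + 1) (2 * m + 2)) = pair_term n J \<sigma>"
proof -
  let ?t = "swap (2 * m + 1) (2 * m + 2)"
  let ?f = "\<lambda>\<sigma> k. J (\<sigma> (2 * k + 1)) (\<sigma> (2 * k + 2))"
  have rest: "(\<Prod>k\<in>{..<n} - {m}. ?f (\<sigma> \<circ> ?t) k) = (\<Prod>k\<in>{..<n} - {m}. ?f \<sigma> k)"
  proof (rule prod.cong [OF refl])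
    fix k assume "k \<in> {..<n} - {m}"
    then have "?t (2 * k + 1) = 2 * k + 1" "?t (2 * k + 2) = 2 * k + 2"
      by (simp add: Transposition.transpose_def; presburger)+
    then show "?f (\<sigma> \<circ> ?t) k = ?f \<sigma> k"
      by (simp del: transpose_apply_other)
  qed
  have factor: "?f (\<sigma> \<circ> ?t) m = - ?f \<sigma> m"
    using J by simp
  have split: "(\<Prod>k<n. ?f \<rho> k) = ?f \<rho> m * (\<Prod>k\<in>{..<n} - {m}. ?f \<rho> k)" for \<rho>
    using assms(1) by (intro prod.remove) auto
  have "(\<Prod>k<n. ?f (\<sigma> \<circ> ?t) k) = - (\<Prod>k<n. ?f \<sigma> k)"
    by (simp only: split [of "\<sigma> \<circ> ?t"] split [of \<sigma>] rest factor mult_minus_left)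
  moreover have "sign (\<sigma> \<circ> ?t) = - sign \<sigma>"
    using assms(2) by (simp add: sign_compose permutation_swap_id sign_swap_id)
  ultimately show ?thesis
    unfolding pair_term_def by (simp only: of_int_minus minus_mult_minus)
qed

text \<open>Each transposition moves positions of one parity only; together they exchange the pairs
  \<open>l\<close> and \<open>m\<close> as blocks.\<close>

lemma transpose_pairs:
  fixes k l m :: nat
  defines "t \<equiv> swap (2 * l + 1) (2 * m + 1) \<circ> swap (2 * l + 2) (2 * m + 2)"
  shows "t (2 * k + 1) = 2 * swap l m k + 1" and "t (2 * k + 2) = 2 * swap l m k + 2"
proof -
  have "swap (2 * l + 2) (2 * m + 2) (2 * k + 1) = 2 * k + 1"
    unfolding Transposition.transpose_def by presburger
  moreover have "swap (2 * l + 1) (2 * m + 1) (2 * k + 1) = 2 * swap l m k + 1"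
    unfolding Transposition.transpose_def by presburger
  ultimately show "t (2 * k + 1) = 2 * swap l m k + 1"
    by (simp only: t_def o_apply)
  have "swap (2 * l + 2) (2 * m + 2) (2 * k + 2) = 2 * swap l m k + 2"
    unfolding Transposition.transpose_def by presburger
  moreover have "swap (2 * l + 1) (2 * m + 1) (2 * j + 2) = 2 * j + 2" for j
    unfolding Transposition.transpose_def by presburger
  ultimately show "t (2 * k + 2) = 2 * swap l m k + 2"
    by (simp only: t_def o_apply)
qed

text \<open>Exchanging two pairs is an even permutation and merely reorders the factors.\<close>

lemma pair_term_swap:
  assumes "l < n" "m < n" "permutation \<sigma>"
  shows "pair_term n J
    (\<sigma> \<circ> (swap (2 * l + 1) (2 * m + 1) \<circ> swap (2 * l + 2) (2 * m + 2))) =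
    pair_term n J \<sigma>"
proof -
  let ?t = "swap (2 * l + 1) (2 * m + 1) \<circ> swap (2 * l + 2) (2 * m + 2)"
  let ?f = "\<lambda>k. J (\<sigma> (2 * k + 1)) (\<sigma> (2 * k + 2))"
  have t: "?t (2 * k + 1) = 2 * swap l m k + 1" "?t (2 * k + 2) = 2 * swap l m k + 2" for k
    by (rule transpose_pairs)+
  have "(\<Prod>k<n. ?f (swap l m k)) = (\<Prod>k<n. ?f k)"
    by (rule prod.reindex_bij_betw [of _ _ _ ?f])
      (use assms in \<open>auto intro!: permutes_imp_bij permutes_swap_id\<close>)
  moreover have "sign ?t = 1"
    by (simp add: sign_compose permutation_swap_id sign_swap_id)
  moreover have "permutation ?t"
    by (simp add: permutation_compose permutation_swap_id)
  ultimately show ?thesis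
    using assms(3)
    unfolding pair_term_def by (simp only: sign_compose o_apply [of \<sigma>] t)
qed

text \<open>
  A nonzero term comes from a permutation of the pairs, possibly with flips inside them. Swapping
  two pairs or flipping one leaves the term unchanged, so such a permutation can be brought to the
  identity one pair at a time; \<open>m\<close> counts the pairs that are already in place.
\<close>

lemma pair_term_nonneg:
  assumes antisym: "\<And>i j. i \<in> {1..2 * n} \<Longrightarrow> j \<in> {1..2 * n} \<Longrightarrow> J j i = - J i j"
    and one: "\<And>k. k < n \<Longrightarrow> J (2 * k + 1) (2 * k + 2) = 1"
    and pairs: "\<And>i j. i \<in> {1..2 * n} \<Longrightarrow> j \<in> {1..2 * n} \<Longrightarrow> J i j \<noteq> 0 \<Longrightarrow>
                  \<exists>k<n. {i, j} = {2 * k + 1, 2 * k + 2}"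
    and "m \<le> n" and "\<sigma> permutes {2 * m + 1..2 * n}"
  shows "pair_term n J \<sigma> \<ge> 0"
  using assms(4,5)
proof (induction m arbitrary: \<sigma> rule: inc_induct)
  \<comment> \<open>At \<open>m = n\<close> the interval is empty, and the term of the identity is
    1.\<close>
  case base
  then have "\<sigma> = id" by simp
  then show ?case by (simp add: pair_term_def one [simplified])
next
  case (step m)
  have perm: "permutation \<rho>" if "\<rho> permutes {2 * m + 1..2 * n}" for \<rho>
    using that by (intro permutes_imp_permutation) auto
  have in_range: "\<rho> i \<in> {1..2 * n}" if "\<rho> permutes {2 * m + 1..2 * n}" "i \<in> {1..2 * n}" for \<rho> i
  proof (cases "i \<in> {2 * m + 1..2 * n}")
    case True
    with that(1) have "\<rho> i \<in> {2 * m + 1..2 * n}" by (simp only: permutes_in_image)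
    then show ?thesis by auto
  next
    case False
    with that show ?thesis by (simp add: permutes_not_in)
  qed
  have *: "pair_term n J \<rho> \<ge> 0"
    if \<rho>: "\<rho> permutes {2 * m + 1..2 * n}" "\<rho> (2 * m + 1) = 2 * m + 1" "\<rho> (2 * m + 2) = 2 * m + 2" for \<rho>
  proof (rule step.IH)
    show "\<rho> permutes {2 * Suc m + 1..2 * n}"
    proof (rule permutes_superset [OF \<rho>(1)])
      fix i assume "i \<in> {2 * m + 1..2 * n} - {2 * Suc m + 1..2 * n}"
      then have "i = 2 * m + 1 \<or> i = 2 * m + 2" by auto
      with \<rho>(2,3) show "\<rho> i = i" by (elim disjE) (simp_all only:)
    qed
  qed
  show ?case
  proof (cases "pair_term n J \<sigma> = 0")
    case False
    \<comment> \<open>The position \<open>j\<close> with value \<open>2 * m + 1\<close> lies in some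
      pair \<open>l\<close>, which is to be moved to place \<open>m\<close>.\<close>
    obtain j where j: "j \<in> {2 * m + 1..2 * n}" "\<sigma> j = 2 * m + 1"
    proof -
      have "2 * m + 1 \<in> \<sigma> ` {2 * m + 1..2 * n}"
        unfolding permutes_image [OF step.prems] using step.hyps by auto
      then show ?thesis using that by (auto simp del: atLeastAtMost_iff)
    qed
    define l where "l = (j - 1) div 2"
    have l: "m \<le> l" "l < n" and jl: "j = 2 * l + 1 \<or> j = 2 * l + 2"
      using j(1) unfolding l_def by (simp_all; presburger)+
    define \<tau> where "\<tau> = swap (2 * l + 1) (2 * m + 1) \<circ> swap (2 * l + 2) (2 * m + 2)"
    define \<rho> where "\<rho> = \<sigma> \<circ> \<tau>"
    \<comment> \<open>A nonzero term has a nonzero factor at \<open>l\<close>, so \<sigma> carries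
      this pair onto a pair \<open>k\<close>. As the latter contains \<open>2 * m + 1\<close>,
      parity forces \<open>k = m\<close>.\<close>
    have "J (\<sigma> (2 * l + 1)) (\<sigma> (2 * l + 2)) \<noteq> 0"
      using False l by (auto simp: pair_term_def)
    then obtain k where k: "k < n" "{\<sigma> (2 * l + 1), \<sigma> (2 * l + 2)} = {2 * k + 1, 2 * k + 2}"
      using pairs [of "\<sigma> (2 * l + 1)" "\<sigma> (2 * l + 2)"] in_range [OF step.prems] l by auto
    moreover have "2 * m + 1 \<in> {\<sigma> (2 * l + 1), \<sigma> (2 * l + 2)}"
      using j jl by auto
    ultimately have "2 * m + 1 = 2 * k + 1 \<or> 2 * m + 1 = 2 * k + 2"
      by blast
    then have "k = m" by presburger
    have \<tau>: "\<tau> (2 * m + 1) = 2 * l + 1" "\<tau> (2 * m + 2) = 2 * l + 2"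
      unfolding \<tau>_def by (simp_all only: transpose_pairs transpose_apply_second)
    from k \<open>k = m\<close> have set: "{\<rho> (2 * m + 1), \<rho> (2 * m + 2)} = {2 * m + 1, 2 * m + 2}"
      unfolding \<rho>_def o_apply \<tau> by (simp only:)
    have "\<tau> permutes {2 * m + 1..2 * n}"
      unfolding \<tau>_def using l step.hyps by (intro permutes_compose permutes_swap_id) auto
    then have \<rho>: "\<rho> permutes {2 * m + 1..2 * n}"
      unfolding \<rho>_def using step.prems by (rule permutes_compose)
    have "pair_term n J \<sigma> = pair_term n J \<rho>"
      unfolding \<rho>_def \<tau>_def using l step.hyps step.prems by (simp only: pair_term_swap perm)
    \<comment> \<open>Since \<rho> preserves the pair \<open>m\<close> as a set, it fixes both
      elements or exchanges them; a flip undoes the exchange.\<close>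
    also have "\<dots> \<ge> 0"
    proof (cases "\<rho> (2 * m + 1) = 2 * m + 1")
      case True
      with set have "\<rho> (2 * m + 2) = 2 * m + 2" by (auto simp: doubleton_eq_iff)
      with True \<rho> show ?thesis by (intro *)
    next
      case False
      let ?t = "swap (2 * m + 1) (2 * m + 2)"
      from set False have "\<rho> (2 * m + 1) = 2 * m + 2" "\<rho> (2 * m + 2) = 2 * m + 1"
        by (auto simp: doubleton_eq_iff)
      moreover have "\<rho> \<circ> ?t permutes {2 * m + 1..2 * n}"
        using step.hyps by (intro permutes_compose [OF _ \<rho>] permutes_swap_id) auto
      ultimately have "pair_term n J (\<rho> \<circ> ?t) \<ge> 0"
        by (intro *) auto
      also have "pair_term n J (\<rho> \<circ> ?t) = pair_term n J \<rho>"
        using step.hyps by (intro pair_term_flip perm [OF \<rho>] antisym in_range [OF \<rho>]) auto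
      finally show ?thesis .
    qed
    finally show ?thesis .
  qed simp
qed

text \<open>As \<alpha> vanishes on all frame vectors but \<open>v 0\<close>, only permutations
  fixing 0 contribute. Their terms are nonnegative and that of the identity is positive, which
  excludes cancellation.\<close>

lemma wedge_power_pos:
  assumes "\<alpha> (v 0) > 0" and ker: "\<And>i. i \<in> {1..2 * n} \<Longrightarrow> \<alpha> (v i) = 0"
    and J: "\<And>i j. i \<in> {1..2 * n} \<Longrightarrow> j \<in> {1..2 * n} \<Longrightarrow> \<beta> (v j) (v i) = - \<beta> (v i) (v j)"
      "\<And>k. k < n \<Longrightarrow> \<beta> (v (2 * k + 1)) (v (2 * k + 2)) = 1"
      "\<And>i j. i \<in> {1..2 * n} \<Longrightarrow> j \<in> {1..2 * n} \<Longrightarrow> \<beta> (v i) (v j) \<noteq> 0 \<Longrightarrow>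
         \<exists>k<n. {i, j} = {2 * k + 1, 2 * k + 2}"
  shows "wedge_power n \<alpha> \<beta> v > 0"
proof -
  let ?J = "\<lambda>i j. \<beta> (v i) (v j)"
  have "(\<Sum>\<sigma> | \<sigma> permutes {..2 * n}. \<alpha> (v (\<sigma> 0)) * pair_term n ?J \<sigma>) > 0"
  proof (rule sum_pos2)
    show "finite {\<sigma>. \<sigma> permutes {..2 * n}}"
      by (simp add: finite_permutations)
    show "id \<in> {\<sigma>. \<sigma> permutes {..2 * n}}"
      by (simp add: permutes_id)
    show "\<alpha> (v (id 0)) * pair_term n ?J id > 0"
      using assms(1) J(2) [simplified] by (simp add: pair_term_def)
    fix \<sigma> assume \<sigma>: "\<sigma> \<in> {\<sigma>. \<sigma> permutes {..2 * n}}"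
    show "\<alpha> (v (\<sigma> 0)) * pair_term n ?J \<sigma> \<ge> 0"
    proof (cases "\<sigma> 0 = 0")
      case True
      have "\<sigma> permutes {2 * 0 + 1..2 * n}"
      proof (rule permutes_superset)
        show "\<sigma> permutes {..2 * n}" using \<sigma> by simp
        fix i assume "i \<in> {..2 * n} - {2 * 0 + 1..2 * n}"
        then have "i = 0" by auto
        with True show "\<sigma> i = i" by simp
      qed
      then have "pair_term n ?J \<sigma> \<ge> 0"
        by (intro pair_term_nonneg [of n ?J 0] J) auto
      with True assms(1) show ?thesis by simp
    next
      case False
      from \<sigma> have "\<sigma> 0 \<in> {..2 * n}" by (simp only: mem_Collect_eq permutes_in_image) simp
      with False have "\<alpha> (v (\<sigma> 0)) = 0" by (intro ker) auto
      then show ?thesis by simp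
    qed
  qed
  then show ?thesis
    by (simp add: wedge_power_def pair_term_def mult_ac)
qed


section \<open>Signatures\<close>

text \<open>The kernel of \<open>g u\<close> contains the other elements of \<open>B\<close>, hence
  their span, but not \<open>u\<close>.\<close>

lemma independent_orthogonal:
  assumes "\<And>u. u \<in> B \<Longrightarrow> linear (g u)" and "pairwise (\<lambda>u v. g u v = (0::real)) B"
    and "\<forall>u\<in>B. g u u \<noteq> 0"
  shows "independent B"
proof
  assume "dependent B"
  then obtain u where u: "u \<in> B" "u \<in> span (B - {u})"
    by (auto simp: dependent_def)
  have "subspace {x. g u x = 0}"
    using assms(1) [OF u(1)] by (rule linear_subspace_kernel)
  moreover have "B - {u} \<subseteq> {x. g u x = 0}"
    using assms(2) u(1) by (auto simp: pairwise_def)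
  ultimately have "g u u = 0"
    using u(2) span_minimal by blast
  with assms(3) u(1) show False by blast
qed

lemma has_signatureI:
  assumes "subspace V" "finite B" "B \<subseteq> V" and lin: "\<And>u. u \<in> B \<Longrightarrow> linear (g u)"
    and orth: "pairwise (\<lambda>u v. g u v = 0) B" and nz: "\<forall>u\<in>B. g u u \<noteq> 0"
    and card: "card {u\<in>B. g u u > 0} = p" "card {u\<in>B. g u u < 0} = q" and "dim V = p + q"
  shows "has_signature V g p q"
proof -
  \<comment> \<open>No square vanishes, so counting signs gives \<open>card B = dim V\<close>; an
    independent set of this size spans \<open>V\<close>.\<close>
  have "B = {u\<in>B. g u u > 0} \<union> {u\<in>B. g u u < 0}"
    using nz by (auto simp: neq_iff)
  then have "card B = card ({u\<in>B. g u u > 0} \<union> {u\<in>B. g u u < 0})"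
    by simp
  also have "\<dots> = p + q"
    unfolding card [symmetric] using \<open>finite B\<close> by (intro card_Un_disjoint) auto
  finally have "dim V \<le> card B" using \<open>dim V = p + q\<close> by simp
  moreover have "independent B"
    using lin orth nz by (rule independent_orthogonal)
  moreover from calculation have "span B = V"
    using assms(1,3) card_ge_dim_independent span_minimal by blast
  ultimately show ?thesis
    using orth nz card by (auto simp: has_signature_def)
qed

lemma has_signature_image:
  assumes "has_signature V g p q" and L: "linear L" "inj L" and g': "\<And>u v. g' (L u) (L v) = g u v"
  shows "has_signature (L ` V) g' p q"
proof -
  from assms(1) obtain B where B: "independent B" "span B = V" "pairwise (\<lambda>u v. g u v = 0) B"
    "\<forall>u\<in>B. g u u \<noteq> 0" "card {u\<in>B. g u u > 0} = p" "card {u\<in>B. g u u < 0} = q"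
    by (auto simp: has_signature_def)
  have "{u\<in>L ` B. g' u u > 0} = L ` {u\<in>B. g u u > 0}" "{u\<in>L ` B. g' u u < 0} = L ` {u\<in>B. g u u < 0}"
    by (auto simp: g')
  moreover have "independent (L ` B)"
    using L B(1) by (intro linear_independent_injective_image inj_on_subset [OF L(2)]) auto
  moreover have "pairwise (\<lambda>u v. g' u v = 0) (L ` B)"
    using B(3) by (auto simp: pairwise_def g')
  ultimately show ?thesis
    unfolding has_signature_def using B L
    by (intro exI [of _ "L ` B"])
      (auto simp: linear_span_image g' card_image inj_on_subset [OF L(2)])
qed


section \<open>The thermodynamical phase space\<close>

lemma thermo_form_inner: "thermo_form m v = fst v + fst (snd m) \<bullet> snd (snd v)"
  by (simp add: thermo_form_def inner_vec_def)

lemma mrugala_metric_inner: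
  "mrugala_metric m v w =
    (fst (snd v) \<bullet> snd (snd w) + snd (snd v) \<bullet> fst (snd w)) + thermo_form m v * thermo_form m w"
  by (simp add: mrugala_metric_def inner_vec_def sum.distrib flip: sum_divide_distrib)

lemma linear_thermo_form: "linear (thermo_form m)"
  by (rule linearI) (simp_all add: thermo_form_inner inner_add_right algebra_simps)

lemma linear_mrugala_metric: "linear (mrugala_metric m v)"
  by (rule linearI)
    (simp_all add: mrugala_metric_inner linear_add [OF linear_thermo_form]
      linear_scale [OF linear_thermo_form] inner_add_right algebra_simps)

lemma mrugala_metric_commute: "mrugala_metric m v w = mrugala_metric m w v"
  by (simp add: mrugala_metric_inner inner_commute mult.commute)

lemma has_signature_mrugala_metric:
  fixes m :: "'n::finite phase"
  shows "has_signature UNIV (mrugala_metric m) (CARD('n) + 1) CARD('n)"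
proof -
  define p where "p = fst (snd m)"
  \<comment> \<open>The first entry puts \<open>P s k\<close> into the kernel of
    \<open>thermo_form m\<close>. Only the pairing of \<open>p\<close> and \<open>x\<close> parts
    remains: squares are \<open>2 * s\<close>, and the families for 1 and -1 are orthogonal.\<close>
  define P :: "real \<Rightarrow> 'n \<Rightarrow> 'n phase" where "P s k = (- s * p $ k, axis k 1, axis k s)" for s and k :: 'n
  define E :: "'n phase" where "E = (1, 0, 0)"
  have axis_nth: "axis k x $ l = (if k = l then x else 0)" for k l :: 'n and x :: real
    by (simp add: axis_def)
  have gP: "mrugala_metric m (P s k) (P t l) = (if k = l then s + t else 0)" for s t k l
    by (simp add: mrugala_metric_inner thermo_form_inner P_def inner_axis axis_nth
        flip: p_def)
  have gE: "mrugala_metric m E (P s k) = 0" "mrugala_metric m (P s k) E = 0"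
    "mrugala_metric m E E = 1" for s k
    by (simp_all add: mrugala_metric_inner thermo_form_inner P_def E_def inner_axis flip: p_def)
  have inj: "inj (P s)" for s
    by (auto simp: P_def inj_on_def axis_eq_axis)
  let ?B = "insert E (range (P 1) \<union> range (P (- 1)))"
  have "E \<notin> range (P 1)"
    by (auto simp: E_def P_def)
  then have pos: "card (insert E (range (P 1))) = CARD('n) + 1"
    by (simp add: card_image inj)
  have neg: "card (range (P (- 1))) = CARD('n)"
    by (simp add: card_image inj)
  have gpos: "mrugala_metric m u u > 0" if "u \<in> insert E (range (P 1))" for u
    using that by (elim insertE rangeE) (simp_all add: gP gE)
  have gneg: "mrugala_metric m u u < 0" if "u \<in> range (P (- 1))" for u
    using that by (elim rangeE) (simp add: gP)
  show ?thesis
  proof (rule has_signatureI [where B = ?B])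
    show "pairwise (\<lambda>u v. mrugala_metric m u v = 0) ?B"
    proof (rule pairwiseI)
      fix u v assume "u \<in> ?B" "v \<in> ?B" "u \<noteq> v"
      then show "mrugala_metric m u v = 0"
        by (elim insertE UnE rangeE) (simp_all add: gP gE inj_eq [OF inj])
    qed
    show "\<forall>u\<in>?B. mrugala_metric m u u \<noteq> 0"
      using gpos gneg by (metis Un_iff insert_iff less_irrefl)
    have "{u\<in>?B. mrugala_metric m u u > 0} = insert E (range (P 1))"
      using gpos gneg less_asym by blast
    then show "card {u\<in>?B. mrugala_metric m u u > 0} = CARD('n) + 1"
      using pos by simp
    have "{u\<in>?B. mrugala_metric m u u < 0} = range (P (- 1))"
      using gpos gneg less_asym by blast
    then show "card {u\<in>?B. mrugala_metric m u u < 0} = CARD('n)"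
      using neg by simp
  qed (auto simp: linear_mrugala_metric)
qed


section \<open>The Heisenberg group as an affine space of matrices\<close>

definition heis_point :: "'n::finite phase \<Rightarrow> 'n hmat" where
  "heis_point m = heis_mat (snd (snd m)) (fst (snd m)) (- fst m)"

text \<open>The linear part of the affine map \<open>heis_point\<close>, which sends 0 to
  \<open>mat 1\<close>.\<close>

definition heis_vec :: "'n::finite phase \<Rightarrow> 'n hmat" where
  "heis_vec m = heis_point m - mat 1"

lemma linear_heis_vec: "linear heis_vec"
  by (rule linearI)
    (auto simp: vec_eq_iff heis_vec_def heis_point_def heis_mat_def mat_def split: sum.split)

lemma linear_heis_chart: "linear heis_chart"
  by (rule linearI)
    (auto simp: vec_eq_iff heis_chart_def a_coord_def b_coord_def z_coord_def)

lemma heis_chart_heis_point [simp]: "heis_chart (heis_point m) = m"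
  by (simp add: heis_point_def heis_chart_heis_mat)

lemma heis_chart_heis_vec [simp]: "heis_chart (heis_vec m) = m"
  by (simp add: heis_vec_def linear_diff [OF linear_heis_chart] heis_mat_one heis_chart_heis_mat
      flip: zero_prod_def)

lemma inj_heis_vec: "inj heis_vec"
  by (rule inj_on_inverseI [of _ heis_chart]) simp

lemma subspace_range_heis_vec: "subspace (range heis_vec)"
  by (simp add: linear_subspace_image linear_heis_vec)

lemma carrier_heisenberg: "carrier heisenberg = range heis_point"
  by (auto simp: heisenberg_def heis_point_def intro!: image_eqI [of _ _ "(- z, b, a)" for z b a])

lemma carrier_heisenberg_affine: "carrier heisenberg = (+) (mat 1) ` range heis_vec"
  by (simp add: carrier_heisenberg image_image heis_vec_def)

lemma tangent_space_heisenberg: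
  "g \<in> carrier heisenberg \<Longrightarrow> tangent_space (carrier heisenberg) g = range heis_vec"
  unfolding carrier_heisenberg_affine
  by (rule tangent_space_affine [OF subspace_range_heis_vec])

section \<open>The form and the metric of the group in the chart\<close>

text \<open>The matrix coordinates are linear, hence equal to their differentials on tangent
  vectors. This identifies the explicit formula with the pullback of
  \<open>thermo_form\<close>.\<close>

lemma heis_form_eq:
  assumes "v \<in> tangent_space (carrier heisenberg) g"
  shows "heis_form g v = thermo_form (heis_chart g) (heis_chart v)"
proof -
  have "linear (z_coord :: 'a hmat \<Rightarrow> _)" "linear (a_coord i)" for i :: 'a
    by (auto intro!: linearI simp: z_coord_def a_coord_def)
  with assms show ?thesis
    by (simp add: heis_form_def differential_linear thermo_form_def heis_chart_def)
qed

lemma heis_metric_eq: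
  assumes "v \<in> tangent_space (carrier heisenberg) g" "w \<in> tangent_space (carrier heisenberg) g"
  shows "heis_metric g v w = mrugala_metric (heis_chart g) (heis_chart v) (heis_chart w)"
  using assms by (simp add: heis_metric_def pullback2_def differential_linear linear_heis_chart)

lemma diffeomorphism_heis_chart:
  "diffeomorphism (carrier heisenberg) (UNIV :: 'n::finite phase set) heis_chart"
proof -
  have bij: "bij_betw heis_chart (carrier heisenberg) (UNIV :: 'n phase set)"
    by (rule bij_betw_byWitness [where f' = heis_point]) (auto simp: carrier_heisenberg)
  moreover have "inv_into (carrier heisenberg) heis_chart m = heis_point m" for m :: "'n phase"
    using bij by (intro inv_into_f_eq) (auto simp: bij_betw_def carrier_heisenberg)
  then have "smooth_map UNIV (inv_into (carrier heisenberg) (heis_chart :: 'n hmat \<Rightarrow> _))"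
    by (intro smooth_map_linear [OF linear_heis_vec, of _ _ "mat 1"]) (simp add: heis_vec_def)
  ultimately show ?thesis
    using smooth_map_linear [OF linear_heis_chart, of "carrier heisenberg" heis_chart 0]
    by (simp add: diffeomorphism_def)
qed

lemma linear_p_coord:
  "linear (\<lambda>g. fst (snd (heis_chart g)) \<bullet> c)"
  by (rule linearI)
    (simp_all add: linear_add [OF linear_heis_chart] linear_scale [OF linear_heis_chart]
      inner_add_left)

text \<open>Since \<open>heis_chart\<close> is linear on all matrices, the chart formula extends the
  form to the whole space, with coefficients affine in \<open>g\<close>.\<close>

lemma form1_extension_heis_form:
  "form1_extension (carrier heisenberg) heis_form UNIV
     (\<lambda>g v. thermo_form (heis_chart g) (heis_chart v))"
proof -
  have "linear (\<lambda>v. thermo_form m (heis_chart v))" for m :: "'a phase"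
    using linear_compose [OF linear_heis_chart linear_thermo_form] by (simp add: o_def)
  moreover have "Ck_on k UNIV (\<lambda>g. thermo_form (heis_chart g) (heis_chart v))" for k and v :: "'a hmat"
    unfolding thermo_form_inner by (rule Ck_on_linear [OF linear_p_coord])
  ultimately show ?thesis
    by (simp add: form1_extension_def smooth_open_def heis_form_eq)
qed

text \<open>This is the sum of the dp_i wedge dx^i. The base point enters the form only through
  \<open>p\<close>, linearly, so the value is the same at every point.\<close>

lemma ext_deriv1_heis_form:
  assumes "g \<in> carrier heisenberg"
  shows "ext_deriv1 (carrier heisenberg) heis_form g (heis_vec u) (heis_vec w) =
    fst (snd u) \<bullet> snd (snd w) - fst (snd w) \<bullet> snd (snd u)"
proof -
  have "((\<lambda>y. thermo_form (heis_chart y) m) has_derivative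
      (\<lambda>h. fst (snd (heis_chart h)) \<bullet> snd (snd m))) (at g)" for m
    unfolding thermo_form_inner
    by (auto intro!: derivative_eq_intros linear_imp_has_derivative linear_p_coord linear_heis_chart)
  from frechet_derivative_at [OF this, symmetric] show ?thesis
    using assms unfolding carrier_heisenberg_affine
    by (subst ext_deriv1_affine [OF subspace_range_heis_vec _ _ form1_extension_heis_form
            [unfolded carrier_heisenberg_affine]]) simp_all
qed

lemma smooth_tensor2_heis_metric: "smooth_tensor2 (carrier heisenberg) heis_metric"
proof -
  have lin: "linear (\<lambda>w. mrugala_metric m v (heis_chart w))" for m v :: "'a phase"
    using linear_compose [OF linear_heis_chart linear_mrugala_metric] by (simp add: o_def)
  moreover have "linear (\<lambda>v. mrugala_metric m (heis_chart v) w)" for m w :: "'a phase"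
    using lin [of m w] by (simp only: mrugala_metric_commute [of m _ w])
  ultimately have "bilinear (\<lambda>v w. mrugala_metric m (heis_chart v) (heis_chart w))" for m :: "'a phase"
    by (simp add: bilinear_def)
  moreover have "Ck_on k UNIV (\<lambda>g. mrugala_metric (heis_chart g) v w)" for k and v w :: "'a phase"
    unfolding mrugala_metric_inner thermo_form_inner
    by (intro Ck_on_mult_linear linear_p_coord)
  ultimately show ?thesis
    unfolding smooth_tensor2_def
    by (intro ballI exI [of _ UNIV]
        exI [of _ "\<lambda>g v w. mrugala_metric (heis_chart g) (heis_chart v) (heis_chart w)"])
      (auto simp: smooth_open_def heis_metric_eq)
qed

section \<open>Contact condition and signature on the group\<close>

lemma contact_form_heis_form:
  "contact_form CARD('n) (carrier (heisenberg :: 'n::finite hmat monoid)) heis_form"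
  unfolding contact_form_def
proof (intro conjI ballI)
  show "smooth_form1 (carrier heisenberg) heis_form"
    unfolding smooth_form1_def using form1_extension_heis_form by blast
next
  fix g :: "'n hmat" assume g: "g \<in> carrier heisenberg"
  note T = tangent_space_heisenberg [OF g]
  have "dim (range (heis_vec :: 'n phase \<Rightarrow> _)) = dim (UNIV :: 'n phase set)"
    by (rule dim_image_eq [OF linear_heis_vec]) (simp add: inj_heis_vec)
  then show "dim (tangent_space (carrier heisenberg) g) = 2 * CARD('n) + 1"
    by (simp add: T)
  obtain e :: "nat \<Rightarrow> 'n" where e: "bij_betw e {..<CARD('n)} UNIV"
    using ex_bij_betw_nat_finite [of "UNIV :: 'n set"] by (auto simp: lessThan_atLeast0)
  define p where "p = fst (snd (heis_chart g))"
  \<comment> \<open>\<open>F 0\<close> is the Reeb vector. Positions \<open>2 * k + 1\<close> and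
    \<open>2 * k + 2\<close> hold, for the coordinate index \<open>e k\<close>, the \<open>p\<close>
    direction and the \<open>x\<close> direction corrected into the kernel of the form at
    \<open>g\<close>.\<close>
  define F :: "nat \<Rightarrow> 'n phase" where
    "F i = (let k = e ((i - 1) div 2) in
       if i = 0 then (1, 0, 0) else if odd i then (0, axis k 1, 0) else (- p $ k, 0, axis k 1))" for i
  let ?d = "ext_deriv1 (carrier heisenberg) heis_form g"
  have d: "?d (heis_vec (F i)) (heis_vec (F j)) =
      (if e ((i - 1) div 2) = e ((j - 1) div 2) then of_bool (odd i) - of_bool (odd j) else 0)"
    if "i \<in> {1..2 * CARD('n)}" "j \<in> {1..2 * CARD('n)}" for i j
    using that by (auto simp: ext_deriv1_heis_form [OF g] F_def Let_def inner_axis_axis)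
  have "wedge_power CARD('n) (heis_form g) ?d (\<lambda>i. heis_vec (F i)) > 0"
  proof (rule wedge_power_pos)
    show "heis_form g (heis_vec (F 0)) > 0"
      by (simp add: heis_form_eq T thermo_form_inner F_def)
    show "heis_form g (heis_vec (F i)) = 0" if "i \<in> {1..2 * CARD('n)}" for i
      using that by (simp add: heis_form_eq T thermo_form_inner F_def Let_def inner_axis flip: p_def)
    show "?d (heis_vec (F j)) (heis_vec (F i)) = - ?d (heis_vec (F i)) (heis_vec (F j))"
      if "i \<in> {1..2 * CARD('n)}" "j \<in> {1..2 * CARD('n)}" for i j
      using that by (simp add: d)
    show "?d (heis_vec (F (2 * k + 1))) (heis_vec (F (2 * k + 2))) = 1" if "k < CARD('n)" for k
      using that by (subst d) auto
    show "\<exists>k<CARD('n). {i, j} = {2 * k + 1, 2 * k + 2}"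
      if ij: "i \<in> {1..2 * CARD('n)}" "j \<in> {1..2 * CARD('n)}"
        and nz: "?d (heis_vec (F i)) (heis_vec (F j)) \<noteq> 0" for i j
    proof -
      from nz d [OF ij] have "e ((i - 1) div 2) = e ((j - 1) div 2)" and parity: "odd i \<noteq> odd j"
        by (auto split: if_splits)
      moreover have lt: "(i - 1) div 2 < CARD('n)" "(j - 1) div 2 < CARD('n)"
        using ij by auto
      ultimately have eq: "(i - 1) div 2 = (j - 1) div 2"
        using e by (auto simp: bij_betw_def inj_on_def)
      define q where "q = (i - 1) div 2"
      \<comment> \<open>A position is recovered from its pair and its parity, so two positions in
        the same pair with opposite parities fill that pair.\<close>
      have half: "l = 2 * ((l - 1) div 2) + (if odd l then 1 else 2)" if "l \<in> {1..2 * CARD('n)}" for l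
        using that by simp presburger
      have "i = 2 * q + (if odd i then 1 else 2)" "j = 2 * q + (if odd j then 1 else 2)"
        using half [OF ij(1)] half [OF ij(2)] by (simp_all only: q_def eq)
      with parity have "{i, j} = {2 * q + 1, 2 * q + 2}"
        by (cases "odd i") (simp_all only: if_True if_False simp_thms, blast+)
      with lt(1) show ?thesis unfolding q_def by blast
    qed
  qed
  then show "\<exists>v. (\<forall>i\<le>2 * CARD('n). v i \<in> tangent_space (carrier heisenberg) g) \<and>
      wedge_power CARD('n) (heis_form g) ?d v \<noteq> 0"
    by (intro exI [of _ "\<lambda>i. heis_vec (F i)"]) (simp add: T)
qed

lemma pseudo_riemannian_metric_heis_metric:
  "pseudo_riemannian_metric (carrier (heisenberg :: 'n::finite hmat monoid)) heis_metric
     (CARD('n) + 1) CARD('n)"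
  unfolding pseudo_riemannian_metric_def
proof (intro conjI ballI)
  show "smooth_tensor2 (carrier heisenberg) heis_metric"
    by (rule smooth_tensor2_heis_metric)
next
  fix g :: "'n hmat" and v w
  assume "v \<in> tangent_space (carrier heisenberg) g" "w \<in> tangent_space (carrier heisenberg) g"
  then show "heis_metric g v w = heis_metric g w v"
    by (simp add: heis_metric_eq mrugala_metric_commute)
next
  fix g :: "'n hmat" assume g: "g \<in> carrier heisenberg"
  show "has_signature (tangent_space (carrier heisenberg) g) (heis_metric g) (CARD('n) + 1) CARD('n)"
    unfolding tangent_space_heisenberg [OF g]
    by (rule has_signature_image [OF has_signature_mrugala_metric linear_heis_vec inj_heis_vec])
      (simp add: heis_metric_eq tangent_space_heisenberg g)
qed

section \<open>Right translations\<close>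

text \<open>Through \<open>differential_linear\<close> this makes a right translation its own
  differential.\<close>

lemma linear_right_translation: "linear (\<lambda>g. g ** h)" for h :: "real^'a^'b::finite"
  by (rule linearI)
    (simp_all add: vec_eq_iff matrix_matrix_mult_def sum.distrib sum_distrib_left algebra_simps)

lemma heis_point_mult:
  "heis_point m ** heis_point h =
    heis_point (fst m + fst h - snd (snd m) \<bullet> fst (snd h), snd m + snd h)"
  by (simp add: heis_point_def heis_mat_mult algebra_simps)

lemma heis_vec_mult:
  "heis_vec u ** heis_point h = heis_vec (fst u - snd (snd u) \<bullet> fst (snd h), snd u)"
proof -
  have "heis_vec u ** heis_point h = heis_point u ** heis_point h - heis_point h"
    by (simp add: heis_vec_def linear_diff [OF linear_right_translation])
  also have "\<dots> = heis_vec (fst u + fst h - snd (snd u) \<bullet> fst (snd h), snd u + snd h) - heis_vec h"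
    by (simp add: heis_point_mult heis_vec_def)
  also have "\<dots> = heis_vec (fst u - snd (snd u) \<bullet> fst (snd h), snd u)"
    by (simp flip: linear_diff [OF linear_heis_vec]) (simp add: minus_prod_def)
  finally show ?thesis .
qed

text \<open>Translation adds the \<open>p\<close> part of \<open>h\<close> to that of
  \<open>m\<close>, while the first entry of a vector loses exactly the extra pairing this creates.
  The other entries of vectors do not change, so the rest of the metric is preserved too.\<close>

lemma pullback_right_translation:
  fixes m u w :: "'n::finite phase"
  shows "thermo_form (heis_chart (heis_point m ** heis_point h)) (heis_chart (heis_vec u ** heis_point h)) =
      thermo_form m u"
    and "mrugala_metric (heis_chart (heis_point m ** heis_point h))
        (heis_chart (heis_vec u ** heis_point h)) (heis_chart (heis_vec w ** heis_point h)) =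
      mrugala_metric m u w"
  by (simp_all add: heis_point_mult heis_vec_mult thermo_form_inner mrugala_metric_inner
      inner_add_left inner_commute [of _ "fst (snd h)"])

text \<open>Supplies the tangency at the translated point that \<open>heis_form_eq\<close> and
  \<open>heis_metric_eq\<close> require.\<close>

lemma mult_in_tangent_space_heisenberg:
  assumes "g \<in> carrier heisenberg" "h \<in> carrier heisenberg"
    and "v \<in> tangent_space (carrier heisenberg) g"
  shows "v ** h \<in> tangent_space (carrier heisenberg) (g ** h)"
proof -
  from assms have "g ** h \<in> carrier heisenberg"
    by (auto simp: carrier_heisenberg heis_point_mult)
  with assms show ?thesis
    by (auto simp: tangent_space_heisenberg) (auto simp: carrier_heisenberg heis_vec_mult)
qed

lemma right_invariant_heis_form: "right_invariant1 heisenberg heis_form"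
  unfolding right_invariant1_def form1_eq_def
proof (intro ballI)
  fix h g v :: "'a hmat"
  assume h: "h \<in> carrier heisenberg" and g: "g \<in> carrier heisenberg"
    and v: "v \<in> tangent_space (carrier heisenberg) g"
  obtain h' g' v' where eq: "h = heis_point h'" "g = heis_point g'" "v = heis_vec v'"
    using h g v tangent_space_heisenberg [OF g] by (auto simp: carrier_heisenberg)
  have "pullback1 (carrier heisenberg) (\<lambda>g. g ** h) heis_form g v =
      thermo_form (heis_chart (g ** h)) (heis_chart (v ** h))"
    using mult_in_tangent_space_heisenberg [OF g h v] v
    by (simp add: pullback1_def differential_linear linear_right_translation heis_form_eq)
  \<comment> \<open>Only the multiplication of \<open>heisenberg\<close> is unfolded; the carrier
    stays folded so that the facts about its tangent vectors apply.\<close>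
  then show "pullback1 (carrier heisenberg) (\<lambda>g. g \<otimes>\<^bsub>heisenberg\<^esub> h) heis_form g v = heis_form g v"
    using v by (simp add: heisenberg_def [THEN arg_cong, of mult] heis_form_eq)
      (simp add: eq pullback_right_translation)
qed

lemma right_invariant_heis_metric: "right_invariant2 heisenberg heis_metric"
  unfolding right_invariant2_def tensor2_eq_def
proof (intro ballI)
  fix h g v w :: "'a hmat"
  assume h: "h \<in> carrier heisenberg" and g: "g \<in> carrier heisenberg"
    and v: "v \<in> tangent_space (carrier heisenberg) g"
    and w: "w \<in> tangent_space (carrier heisenberg) g"
  obtain h' g' v' w' where eq: "h = heis_point h'" "g = heis_point g'" "v = heis_vec v'" "w = heis_vec w'"
    using h g v w tangent_space_heisenberg [OF g] by (auto simp: carrier_heisenberg)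
  have "pullback2 (carrier heisenberg) (\<lambda>g. g ** h) heis_metric g v w =
      mrugala_metric (heis_chart (g ** h)) (heis_chart (v ** h)) (heis_chart (w ** h))"
    using mult_in_tangent_space_heisenberg [OF g h v] mult_in_tangent_space_heisenberg [OF g h w] v w
    by (simp add: pullback2_def differential_linear linear_right_translation heis_metric_eq)
  then show "pullback2 (carrier heisenberg) (\<lambda>g. g \<otimes>\<^bsub>heisenberg\<^esub> h) heis_metric g v w = heis_metric g v w"
    using v w by (simp add: heisenberg_def [THEN arg_cong, of mult] heis_metric_eq)
      (simp add: eq pullback_right_translation)
qed

theorem theorem1:
  shows "metric_contact_isomorphism
           (carrier (heisenberg :: 'n::finite hmat monoid)) heis_form heis_metric
           (UNIV :: 'n phase set) thermo_form mrugala_metric heis_chart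
       \<and> contact_form CARD('n) (carrier (heisenberg :: 'n hmat monoid)) heis_form
       \<and> pseudo_riemannian_metric (carrier (heisenberg :: 'n hmat monoid)) heis_metric
           (CARD('n) + 1) CARD('n)
       \<and> right_invariant1 (heisenberg :: 'n hmat monoid) heis_form
       \<and> right_invariant2 (heisenberg :: 'n hmat monoid) heis_metric"
proof (intro conjI)
  show "metric_contact_isomorphism (carrier (heisenberg :: 'n hmat monoid)) heis_form heis_metric
      UNIV thermo_form mrugala_metric heis_chart"
    unfolding metric_contact_isomorphism_def
    by (simp add: diffeomorphism_heis_chart form1_eq_def tensor2_eq_def pullback1_def
        heis_form_eq differential_linear linear_heis_chart heis_metric_def)
qed (rule contact_form_heis_form pseudo_riemannian_metric_heis_metric
    right_invariant_heis_form right_invariant_heis_metric)+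

end
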